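(* Let $E$ be an instanton of charge $n$ on $Y$, let $$\gamma' : H\otimes \mathcal U \to H^*\otimes \mathcal U^\perp$$ be the initial part of a monad for $E$, and let $\gamma : A^*\to S^2H^*$ be the linear map associated with the monad. Then $\gamma$ is injective.
   Context: Work over $\mathbb C$. Let $W$ be a $2$-dimensional vector space, $V=S^4W$ ($\dim V=5$), and let $A\cong S^2W$ be the unique $3$-dimensional $SL_2(W)$-subrepresentation of $\Lambda^2V^*\cong S^2W\oplus S^6W$; all non-zero forms in $A$ have rank $4$. Let $Y=\mathrm{Gr}(2,V)\cap \mathbb P(A^\perp)\subset\mathbb P(\Lambda^2V)$, a smooth Fano threefold of index $2$ and degree $5$ with $\mathrm{Pic}(Y)=\mathbb Z\cdot\mathcal O_Y(1)$. Even cohomology groups of $Y$ are identified with $\mathbb Z$, so Chern classes are regarded as integers. Let $\mathcal U$ be the restriction to $Y$ of the rank $2$ tautological subbundle and $\mathcal U^\perp=\ker(V^*\otimes\mathcal O_Y\to\mathcal U^* )$. There is a canonical identification $\mathrm{Hom}(\mathcal U,\mathcal U^\perp)=A$: a form $a\in A$, viewed as a map $V\to V^*$, sends $\mathcal U\subset V\otimes\mathcal O_Y$ into $\mathcal U^\perp\subset V^*\otimes\mathcal O_Y$. An instanton on $Y$ is a $\mu$-stable rank $2$ vector bundle $E$ with $c_1(E)=0$ and $H^1(Y,E(-1))=0$; its charge is $n=c_2(E)$. Let $H$ be an $n$-dimensional vector space. Every instanton $E$ of charge $n$ is the middle cohomology of a complex (a monad for $E$) $$0\to H\otimes\mathcal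 U\xrightarrow{\gamma'}H^*\otimes\mathcal U^\perp\to H'\otimes\mathcal O_Y\to0,\qquad \dim H'=n-2,$$ whose first map is fiberwise injective and whose last map is surjective, and where $\gamma'$ is induced, via $\mathrm{Hom}(\mathcal U,\mathcal U^\perp)=A$, by an element $\gamma\in A\otimes S^2H^*$. The same letter denotes the linear map $\gamma:A^*\to S^2H^*$ corresponding to this element. *)

theory Defs
  imports "HOL-Analysis.Analysis" "HOL-Algebra.Module"
begin

section \<open>The representation \<open>V = S\<^sup>4 W\<close> and the net of forms \<open>A\<close>\<close>

text \<open>
  \<open>W = \<complex>\<^sup>2\<close> with coordinate basis \<open>x, y\<close>, and \<open>V = \<complex>\<^sup>5\<close> is the space of binary quartics
  \<open>v\<^sub>0 y\<^sup>4 + v\<^sub>1 x y\<^sup>3 + \<dots> + v\<^sub>4 x\<^sup>4\<close>.  The index type \<open>5\<close> is the ring of integers mod 5, so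
  \<open>of_nat\<close> enumerates it bijectively on \<open>{..4}\<close>.
\<close>

definition quartic :: "complex^5 \<Rightarrow> complex^2 \<Rightarrow> complex" where
  "quartic v p = (\<Sum>i\<le>4. v $ of_nat i * (p $ 1) ^ i * (p $ 2) ^ (4 - i))"

definition sl2_act :: "complex^2^2 \<Rightarrow> complex^5 \<Rightarrow> complex^5" where
  "sl2_act g v = (THE v'. \<forall>p. quartic v' p = quartic v (p v* g))"

text \<open>
  Bilinear forms on \<open>V\<close> and bivectors are both written in coordinates indexed by pairs;
  \<open>contract a v\<close> is the image of \<open>v\<close> under the map \<open>V \<rightarrow> V\<^sup>*\<close> given by the form \<open>a\<close>.
\<close>

definition form :: "complex^(5 \<times> 5) \<Rightarrow> complex^5 \<Rightarrow> complex^5 \<Rightarrow> complex" where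
  "form a v w = (\<Sum>i\<in>UNIV. \<Sum>j\<in>UNIV. a $ (i, j) * v $ i * w $ j)"

definition contract :: "complex^(5 \<times> 5) \<Rightarrow> complex^5 \<Rightarrow> complex^5" where
  "contract a v = (\<chi> j. \<Sum>i\<in>UNIV. a $ (i, j) * v $ i)"

definition wedge :: "complex^5 \<Rightarrow> complex^5 \<Rightarrow> complex^(5 \<times> 5)" where
  "wedge v w = (\<chi> p. v $ fst p * w $ snd p - v $ snd p * w $ fst p)"

definition alternating_form :: "complex^(5 \<times> 5) \<Rightarrow> bool" where
  "alternating_form a \<longleftrightarrow> (\<forall>v. form a v v = 0)"

definition sl2_net :: "(complex^(5 \<times> 5)) set \<Rightarrow> bool" where
  "sl2_net A \<longleftrightarrow> vec.subspace A \<and> vec.dim A = 3 \<and> (\<forall>a\<in>A. alternating_form a) \<and>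
     (\<forall>g. det g = 1 \<longrightarrow>
        (\<forall>a\<in>A. \<exists>b\<in>A. \<forall>v w. form b v w = form a (sl2_act g v) (sl2_act g w)))"

section \<open>The threefold \<open>Y\<close> as a projective variety\<close>

text \<open>A point of \<open>Gr(2,V)\<close> is a plane in \<open>V\<close>; it lies in \<open>\<P>(A\<^sup>\<bottom>)\<close> iff all forms of \<open>A\<close> vanish on it.\<close>

type_synonym point = "(complex^5) set"

definition Y :: "(complex^(5 \<times> 5)) set \<Rightarrow> point set" where
  "Y A = {L. vec.subspace L \<and> vec.dim L = 2 \<and> (\<forall>a\<in>A. \<forall>v\<in>L. \<forall>w\<in>L. form a v w = 0)}"

text \<open>The punctured line in \<open>\<Lambda>\<^sup>2V\<close> which is the Pluecker image of a plane.\<close>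

definition pluecker :: "point \<Rightarrow> (complex^(5 \<times> 5)) set" where
  "pluecker L = {wedge v w | v w. v \<in> L \<and> w \<in> L} - {0}"

inductive homog :: "nat \<Rightarrow> (complex^'i \<Rightarrow> complex) \<Rightarrow> bool" where
  homog_const: "homog 0 (\<lambda>_. c)"
| homog_coord: "homog 1 (\<lambda>x. x $ i)"
| homog_add: "homog d P \<Longrightarrow> homog d Q \<Longrightarrow> homog d (\<lambda>x. P x + Q x)"
| homog_mult: "homog d P \<Longrightarrow> homog e Q \<Longrightarrow> homog (d + e) (\<lambda>x. P x * Q x)"

definition zariski :: "(complex^(5 \<times> 5)) set \<Rightarrow> point topology" where
  "zariski A = topology_generated_by
     {{y \<in> Y A. \<forall>\<omega>\<in>pluecker y. Q \<omega> \<noteq> 0} | d Q. homog d Q}"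

definition opens :: "(complex^(5 \<times> 5)) set \<Rightarrow> point set set" where
  "opens A = {U. openin (zariski A) U}"

text \<open>
  \<open>s z \<omega>\<close> is locally a quotient \<open>P \<omega> / Q \<omega>\<close> of homogeneous polynomials whose degrees
  differ by \<open>k\<close>.
\<close>

definition locally_rational ::
  "(complex^(5 \<times> 5)) set \<Rightarrow> int \<Rightarrow> point set \<Rightarrow> (point \<Rightarrow> complex^(5 \<times> 5) \<Rightarrow> complex) \<Rightarrow> bool" where
  "locally_rational A k U s \<longleftrightarrow>
     (\<forall>y\<in>U. \<exists>N\<in>opens A. y \<in> N \<and> N \<subseteq> U \<and>
        (\<exists>d e P Q. homog d P \<and> homog e Q \<and> int d = int e + k \<and>
           (\<forall>z\<in>N. \<forall>\<omega>\<in>pluecker z. Q \<omega> \<noteq> 0 \<and> s z \<omega> = P \<omega> / Q \<omega>)))"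

definition regular :: "(complex^(5 \<times> 5)) set \<Rightarrow> point set \<Rightarrow> (point \<Rightarrow> complex) set" where
  "regular A U = {f \<in> extensional U. locally_rational A 0 U (\<lambda>y _. f y)}"

definition OY :: "(complex^(5 \<times> 5)) set \<Rightarrow> point set \<Rightarrow> (point \<Rightarrow> complex) ring" where
  "OY A U = \<lparr>carrier = regular A U, monoid.mult = (\<lambda>f g. \<lambda>y\<in>U. f y * g y), one = (\<lambda>y\<in>U. 1),
     zero = (\<lambda>y\<in>U. 0), add = (\<lambda>f g. \<lambda>y\<in>U. f y + g y)\<rparr>"

section \<open>Sheaves of \<open>\<O>\<^sub>Y\<close>-modules\<close>

record 's omod =
  sections :: "point set \<Rightarrow> (point \<Rightarrow> complex, 's) module"
  restr :: "point set \<Rightarrow> point set \<Rightarrow> 's \<Rightarrow> 's"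

text \<open>
  The module records of \<open>HOL-Algebra\<close> carry two multiplicative fields that play no role for
  modules; they are left unspecified.
\<close>

definition mk_module ::
  "'s set \<Rightarrow> 's \<Rightarrow> ('s \<Rightarrow> 's \<Rightarrow> 's) \<Rightarrow> ('r \<Rightarrow> 's \<Rightarrow> 's) \<Rightarrow> ('r, 's) module" where
  "mk_module C z ad sm = \<lparr>carrier = C, monoid.mult = undefined, one = undefined,
     zero = z, add = ad, smult = sm\<rparr>"

definition omodule :: "(complex^(5 \<times> 5)) set \<Rightarrow> 's omod \<Rightarrow> bool" where
  "omodule A M \<longleftrightarrow>
     (\<forall>U\<in>opens A. Module.module (OY A U) (sections M U)) \<and>
     (\<forall>U\<in>opens A. \<forall>W\<in>opens A. W \<subseteq> U \<longrightarrow>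
        restr M U W \<in> carrier (sections M U) \<rightarrow> carrier (sections M W) \<and>
        (\<forall>s\<in>carrier (sections M U). \<forall>t\<in>carrier (sections M U).
           restr M U W (s \<oplus>\<^bsub>sections M U\<^esub> t) = restr M U W s \<oplus>\<^bsub>sections M W\<^esub> restr M U W t) \<and>
        (\<forall>f\<in>regular A U. \<forall>s\<in>carrier (sections M U).
           restr M U W (f \<odot>\<^bsub>sections M U\<^esub> s) = restrict f W \<odot>\<^bsub>sections M W\<^esub> restr M U W s)) \<and>
     (\<forall>U\<in>opens A. \<forall>s\<in>carrier (sections M U). restr M U U s = s) \<and>
     (\<forall>U\<in>opens A. \<forall>W\<in>opens A. \<forall>X\<in>opens A. X \<subseteq> W \<longrightarrow> W \<subseteq> U \<longrightarrow>
        (\<forall>s\<in>carrier (sections M U). restr M W X (restr M U W s) = restr M U X s)) \<and>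
     (\<forall>\<C> \<sigma>. \<C> \<subseteq> opens A \<longrightarrow> (\<forall>W\<in>\<C>. \<sigma> W \<in> carrier (sections M W)) \<longrightarrow>
        (\<forall>W\<in>\<C>. \<forall>X\<in>\<C>. restr M W (W \<inter> X) (\<sigma> W) = restr M X (W \<inter> X) (\<sigma> X)) \<longrightarrow>
        (\<exists>!s. s \<in> carrier (sections M (\<Union>\<C>)) \<and> (\<forall>W\<in>\<C>. restr M (\<Union>\<C>) W s = \<sigma> W)))"

text \<open>
  A morphism is a family of maps indexed by the open sets; the open set \<open>T\<close> allows for
  morphisms between the restrictions to \<open>T\<close>.
\<close>

definition morphism_on ::
  "(complex^(5 \<times> 5)) set \<Rightarrow> point set \<Rightarrow> 's omod \<Rightarrow> 't omod \<Rightarrow> (point set \<Rightarrow> 's \<Rightarrow> 't) \<Rightarrow> bool" where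
  "morphism_on A T M N \<phi> \<longleftrightarrow>
     (\<forall>U\<in>opens A. U \<subseteq> T \<longrightarrow>
        \<phi> U \<in> carrier (sections M U) \<rightarrow> carrier (sections N U) \<and>
        (\<forall>s\<in>carrier (sections M U). \<forall>t\<in>carrier (sections M U).
           \<phi> U (s \<oplus>\<^bsub>sections M U\<^esub> t) = \<phi> U s \<oplus>\<^bsub>sections N U\<^esub> \<phi> U t) \<and>
        (\<forall>f\<in>regular A U. \<forall>s\<in>carrier (sections M U).
           \<phi> U (f \<odot>\<^bsub>sections M U\<^esub> s) = f \<odot>\<^bsub>sections N U\<^esub> \<phi> U s) \<and>
        (\<forall>W\<in>opens A. W \<subseteq> U \<longrightarrow>
           (\<forall>s\<in>carrier (sections M U). \<phi> W (restr M U W s) = restr N U W (\<phi> U s))))"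

abbreviation morphism ::
  "(complex^(5 \<times> 5)) set \<Rightarrow> 's omod \<Rightarrow> 't omod \<Rightarrow> (point set \<Rightarrow> 's \<Rightarrow> 't) \<Rightarrow> bool" where
  "morphism A \<equiv> morphism_on A (Y A)"

definition mono_morphism ::
  "(complex^(5 \<times> 5)) set \<Rightarrow> 's omod \<Rightarrow> 't omod \<Rightarrow> (point set \<Rightarrow> 's \<Rightarrow> 't) \<Rightarrow> bool" where
  "mono_morphism A M N \<phi> \<longleftrightarrow> morphism A M N \<phi> \<and>
     (\<forall>U\<in>opens A. inj_on (\<phi> U) (carrier (sections M U)))"

definition isomorphic :: "(complex^(5 \<times> 5)) set \<Rightarrow> 's omod \<Rightarrow> 't omod \<Rightarrow> bool" where
  "isomorphic A M N \<longleftrightarrow> (\<exists>\<phi>. morphism A M N \<phi> \<and>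
     (\<forall>U\<in>opens A. bij_betw (\<phi> U) (carrier (sections M U)) (carrier (sections N U))))"

text \<open>Sections of \<open>N\<close> over \<open>U\<close> lying in the image sheaf, i.e. locally in the image of \<open>\<phi>\<close>.\<close>

definition image_sections ::
  "(complex^(5 \<times> 5)) set \<Rightarrow> 's omod \<Rightarrow> 't omod \<Rightarrow> (point set \<Rightarrow> 's \<Rightarrow> 't) \<Rightarrow> point set \<Rightarrow> 't set" where
  "image_sections A M N \<phi> U = {t \<in> carrier (sections N U).
     \<forall>y\<in>U. \<exists>W\<in>opens A. y \<in> W \<and> W \<subseteq> U \<and> restr N U W t \<in> \<phi> W ` carrier (sections M W)}"

definition kernel_sections ::
  "'s omod \<Rightarrow> 't omod \<Rightarrow> (point set \<Rightarrow> 's \<Rightarrow> 't) \<Rightarrow> point set \<Rightarrow> 's set" where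
  "kernel_sections M N \<phi> U = {s \<in> carrier (sections M U). \<phi> U s = \<zero>\<^bsub>sections N U\<^esub>}"

definition epi_morphism ::
  "(complex^(5 \<times> 5)) set \<Rightarrow> 's omod \<Rightarrow> 't omod \<Rightarrow> (point set \<Rightarrow> 's \<Rightarrow> 't) \<Rightarrow> bool" where
  "epi_morphism A M N \<phi> \<longleftrightarrow> morphism A M N \<phi> \<and>
     (\<forall>U\<in>opens A. image_sections A M N \<phi> U = carrier (sections N U))"

definition kernel_sheaf :: "'s omod \<Rightarrow> 't omod \<Rightarrow> (point set \<Rightarrow> 's \<Rightarrow> 't) \<Rightarrow> 's omod" where
  "kernel_sheaf M N \<phi> = M\<lparr>sections := (\<lambda>U. sections M U\<lparr>carrier := kernel_sections M N \<phi> U\<rparr>)\<rparr>"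

definition short_exact ::
  "(complex^(5 \<times> 5)) set \<Rightarrow> 's omod \<Rightarrow> 's omod \<Rightarrow> 's omod \<Rightarrow> bool" where
  "short_exact A M' M M'' \<longleftrightarrow> (\<exists>\<iota> \<pi>. mono_morphism A M' M \<iota> \<and> epi_morphism A M M'' \<pi> \<and>
     (\<forall>U\<in>opens A. image_sections A M' M \<iota> U = kernel_sections M M'' \<pi> U))"

text \<open>
  \<open>E\<close> is the middle cohomology \<open>ker \<beta> / im \<alpha>\<close> of the complex \<open>M\<^sub>1 \<rightarrow> M\<^sub>2 \<rightarrow> M\<^sub>3\<close>: there is a sheaf
  epimorphism from \<open>ker \<beta>\<close> onto \<open>E\<close> with kernel \<open>im \<alpha>\<close>.
\<close>

definition middle_cohomology ::
  "(complex^(5 \<times> 5)) set \<Rightarrow> 's omod \<Rightarrow> 'a omod \<Rightarrow> (point set \<Rightarrow> 'a \<Rightarrow> 'b) \<Rightarrow> 'b omod \<Rightarrow>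
   (point set \<Rightarrow> 'b \<Rightarrow> 'c) \<Rightarrow> 'c omod \<Rightarrow> bool" where
  "middle_cohomology A E M\<^sub>1 \<alpha> M\<^sub>2 \<beta> M\<^sub>3 \<longleftrightarrow>
     morphism A M\<^sub>1 M\<^sub>2 \<alpha> \<and> morphism A M\<^sub>2 M\<^sub>3 \<beta> \<and>
     (\<forall>U\<in>opens A. \<forall>s\<in>carrier (sections M\<^sub>1 U). \<beta> U (\<alpha> U s) = \<zero>\<^bsub>sections M\<^sub>3 U\<^esub>) \<and>
     (\<exists>\<pi>. epi_morphism A (kernel_sheaf M\<^sub>2 M\<^sub>3 \<beta>) E \<pi> \<and>
        (\<forall>U\<in>opens A. kernel_sections (kernel_sheaf M\<^sub>2 M\<^sub>3 \<beta>) E \<pi> U = image_sections A M\<^sub>1 M\<^sub>2 \<alpha> U))"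

section \<open>Locally free and coherent sheaves, rank\<close>

text \<open>\<open>lincomb M U W n f s\<close> is \<open>\<Sum>\<^sub>i f\<^sub>i \<cdot> s\<^sub>i\<close> on \<open>W \<subseteq> U\<close>, with \<open>s\<^sub>i\<close> over \<open>U\<close> and \<open>f\<^sub>i\<close> over \<open>W\<close>.\<close>

definition lincomb ::
  "'s omod \<Rightarrow> point set \<Rightarrow> point set \<Rightarrow> nat \<Rightarrow> (nat \<Rightarrow> point \<Rightarrow> complex) \<Rightarrow> (nat \<Rightarrow> 's) \<Rightarrow> 's" where
  "lincomb M U W n f s =
     (\<Oplus>\<^bsub>sections M W\<^esub>i\<in>{..<n}. f i \<odot>\<^bsub>sections M W\<^esub> restr M U W (s i))"

definition free_on :: "(complex^(5 \<times> 5)) set \<Rightarrow> 's omod \<Rightarrow> point set \<Rightarrow> nat \<Rightarrow> bool" where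
  "free_on A M U r \<longleftrightarrow> (\<exists>s\<in>{..<r} \<rightarrow> carrier (sections M U).
     \<forall>W\<in>opens A. W \<subseteq> U \<longrightarrow> (\<forall>t\<in>carrier (sections M W).
        \<exists>!f. f \<in> {..<r} \<rightarrow>\<^sub>E regular A W \<and> t = lincomb M U W r f s))"

definition vector_bundle :: "(complex^(5 \<times> 5)) set \<Rightarrow> 's omod \<Rightarrow> nat \<Rightarrow> bool" where
  "vector_bundle A M r \<longleftrightarrow> omodule A M \<and> (\<forall>y\<in>Y A. \<exists>U\<in>opens A. y \<in> U \<and> free_on A M U r)"

text \<open>Generic rank: \<open>Y\<close> is integral, so a coherent sheaf is free on some non-empty open set.\<close>

definition rank_of :: "(complex^(5 \<times> 5)) set \<Rightarrow> 's omod \<Rightarrow> nat" where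
  "rank_of A M = (THE r. \<exists>U\<in>opens A. U \<noteq> {} \<and> free_on A M U r)"

definition generated_on ::
  "(complex^(5 \<times> 5)) set \<Rightarrow> 's omod \<Rightarrow> point set \<Rightarrow> nat \<Rightarrow> (nat \<Rightarrow> 's) \<Rightarrow> bool" where
  "generated_on A M U n s \<longleftrightarrow>
     (\<forall>W\<in>opens A. W \<subseteq> U \<longrightarrow> (\<forall>t\<in>carrier (sections M W). \<forall>z\<in>W.
        \<exists>N\<in>opens A. z \<in> N \<and> N \<subseteq> W \<and>
          (\<exists>f\<in>{..<n} \<rightarrow> regular A N. restr M W N t = lincomb M U N n f s)))"

definition finite_type_on :: "(complex^(5 \<times> 5)) set \<Rightarrow> 's omod \<Rightarrow> point set \<Rightarrow> bool" where
  "finite_type_on A M U \<longleftrightarrow>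
     (\<forall>y\<in>U. \<exists>N\<in>opens A. y \<in> N \<and> N \<subseteq> U \<and>
        (\<exists>n. \<exists>s\<in>{..<n} \<rightarrow> carrier (sections M N). generated_on A M N n s))"

text \<open>The sheaf on \<open>U\<close> of relations between \<open>s\<^sub>0, \<dots>, s\<^sub>n\<^sub>-\<^sub>1 \<in> M(U)\<close>; only open subsets of \<open>U\<close> matter.\<close>

definition relation_sheaf ::
  "(complex^(5 \<times> 5)) set \<Rightarrow> 's omod \<Rightarrow> point set \<Rightarrow> nat \<Rightarrow> (nat \<Rightarrow> 's) \<Rightarrow>
   (nat \<Rightarrow> point \<Rightarrow> complex) omod" where
  "relation_sheaf A M U n s = \<lparr>
     sections = (\<lambda>W. mk_module
        {f \<in> {..<n} \<rightarrow>\<^sub>E regular A W. lincomb M U W n f s = \<zero>\<^bsub>sections M W\<^esub>}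
        (\<lambda>i\<in>{..<n}. \<lambda>y\<in>W. 0)
        (\<lambda>f g. \<lambda>i\<in>{..<n}. \<lambda>y\<in>W. f i y + g i y)
        (\<lambda>c f. \<lambda>i\<in>{..<n}. \<lambda>y\<in>W. c y * f i y)),
     restr = (\<lambda>W X f. \<lambda>i\<in>{..<n}. restrict (f i) X)\<rparr>"

definition coherent_sheaf :: "(complex^(5 \<times> 5)) set \<Rightarrow> 's omod \<Rightarrow> bool" where
  "coherent_sheaf A M \<longleftrightarrow> omodule A M \<and> finite_type_on A M (Y A) \<and>
     (\<forall>U\<in>opens A. \<forall>n. \<forall>s\<in>{..<n} \<rightarrow> carrier (sections M U).
        finite_type_on A (relation_sheaf A M U n s) U)"

section \<open>The sheaves that occur in the statement\<close>

text \<open>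
  A section of \<open>\<O>\<^sub>Y(k)\<close> assigns to each point \<open>y\<close> a function on the punctured line over \<open>y\<close>,
  homogeneous of degree \<open>k\<close>.
\<close>

definition line_bundle ::
  "(complex^(5 \<times> 5)) set \<Rightarrow> int \<Rightarrow> (point \<Rightarrow> complex^(5 \<times> 5) \<Rightarrow> complex) omod" where
  "line_bundle A k = \<lparr>
     sections = (\<lambda>U. mk_module
        {s \<in> extensional U. (\<forall>y\<in>U. s y \<in> extensional (pluecker y)) \<and> locally_rational A k U s}
        (\<lambda>y\<in>U. \<lambda>\<omega>\<in>pluecker y. 0)
        (\<lambda>s t. \<lambda>y\<in>U. \<lambda>\<omega>\<in>pluecker y. s y \<omega> + t y \<omega>)
        (\<lambda>f s. \<lambda>y\<in>U. \<lambda>\<omega>\<in>pluecker y. f y * s y \<omega>)),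
     restr = (\<lambda>U W s. restrict s W)\<rparr>"

definition hom_sheaf ::
  "(complex^(5 \<times> 5)) set \<Rightarrow> 't omod \<Rightarrow> 's omod \<Rightarrow> (point set \<Rightarrow> 't \<Rightarrow> 's) omod" where
  "hom_sheaf A L M = \<lparr>
     sections = (\<lambda>U. mk_module
        {\<phi> \<in> extensional {W \<in> opens A. W \<subseteq> U}.
           (\<forall>W\<in>opens A. W \<subseteq> U \<longrightarrow> \<phi> W \<in> extensional (carrier (sections L W))) \<and>
           morphism_on A U L M \<phi>}
        (\<lambda>W\<in>{W \<in> opens A. W \<subseteq> U}. \<lambda>s\<in>carrier (sections L W). \<zero>\<^bsub>sections M W\<^esub>)
        (\<lambda>\<phi> \<psi>. \<lambda>W\<in>{W \<in> opens A. W \<subseteq> U}. \<lambda>s\<in>carrier (sections L W).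
           \<phi> W s \<oplus>\<^bsub>sections M W\<^esub> \<psi> W s)
        (\<lambda>f \<phi>. \<lambda>W\<in>{W \<in> opens A. W \<subseteq> U}. \<lambda>s\<in>carrier (sections L W).
           restrict f W \<odot>\<^bsub>sections M W\<^esub> \<phi> W s)),
     restr = (\<lambda>U W \<phi>. restrict \<phi> {X \<in> opens A. X \<subseteq> W})\<rparr>"

text \<open>\<open>E(k) = E \<otimes> \<O>\<^sub>Y(-k)\<^sup>\<or>\<close>, realised as the sheaf of homomorphisms \<open>\<O>\<^sub>Y(-k) \<rightarrow> E\<close>.\<close>

definition twist ::
  "(complex^(5 \<times> 5)) set \<Rightarrow> 's omod \<Rightarrow> int \<Rightarrow>
   (point set \<Rightarrow> (point \<Rightarrow> complex^(5 \<times> 5) \<Rightarrow> complex) \<Rightarrow> 's) omod" where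
  "twist A E k = hom_sheaf A (line_bundle A (- k)) E"

text \<open>
  The sheaf of regular maps \<open>s\<close> to a vector space with \<open>s y\<close> in a prescribed subspace \<open>fib y\<close>;
  for a subbundle of a trivial bundle, given by its fibres, this is its sheaf of sections.
\<close>

definition fibre_sheaf ::
  "(complex^(5 \<times> 5)) set \<Rightarrow> (point \<Rightarrow> (complex^'i) set) \<Rightarrow> (point \<Rightarrow> complex^'i) omod" where
  "fibre_sheaf A fib = \<lparr>
     sections = (\<lambda>U. mk_module
        {s \<in> extensional U. (\<forall>y\<in>U. s y \<in> fib y) \<and> (\<forall>i. (\<lambda>y\<in>U. s y $ i) \<in> regular A U)}
        (\<lambda>y\<in>U. 0)
        (\<lambda>s t. \<lambda>y\<in>U. s y + t y)
        (\<lambda>f s. \<lambda>y\<in>U. f y *s s y)),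
     restr = (\<lambda>U W s. restrict s W)\<rparr>"

text \<open>
  With \<open>H = \<complex>\<^sup>n\<close>, an element of \<open>H \<otimes> V\<close> (or \<open>H\<^sup>* \<otimes> V\<^sup>*\<close>) is a vector indexed by pairs; its
  component at \<open>h\<close> is a vector of \<open>V\<close> (or a covector, in dual coordinates).  The fibre of the
  tautological bundle \<open>\<U>\<close> at the point \<open>y\<close> is \<open>y\<close> itself, that of \<open>\<U>\<^sup>\<bottom>\<close> is the annihilator of \<open>y\<close>.
\<close>

definition component :: "complex^('n::finite \<times> 5) \<Rightarrow> 'n \<Rightarrow> complex^5" where
  "component x h = (\<chi> i. x $ (h, i))"

definition annihilator :: "point \<Rightarrow> (complex^5) set" where
  "annihilator y = {\<xi>. \<forall>v\<in>y. (\<Sum>i\<in>UNIV. \<xi> $ i * v $ i) = 0}"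

definition H_U_fibre :: "point \<Rightarrow> (complex^('n::finite \<times> 5)) set" where
  "H_U_fibre y = {x. \<forall>h. component x h \<in> y}"

definition H_Uperp_fibre :: "point \<Rightarrow> (complex^('n::finite \<times> 5)) set" where
  "H_Uperp_fibre y = {x. \<forall>h. component x h \<in> annihilator y}"

section \<open>Chern classes\<close>

text \<open>
  Under the identifications of the even cohomology with \<open>\<int>\<close> (hyperplane class in degree 2,
  class of a line in degree 4) one has \<open>h\<^sup>2 = 5\<close>, the degree of \<open>Y\<close>.  The first two Chern
  classes of coherent sheaves on \<open>Y\<close> are normalised by \<open>c(\<O>\<^sub>Y(k)) = 1 + k h\<close> and satisfy the
  Whitney formula on short exact sequences.  On \<open>Y\<close> this determines them, without functoriality
  in the variety: the classes of the \<open>\<O>\<^sub>Y(k)\<close> span \<open>K\<^sub>0(Y) \<otimes> \<rat>\<close>, and the target is torsion free.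
\<close>

definition chern_theory ::
  "(complex^(5 \<times> 5)) set \<Rightarrow> ('s omod \<Rightarrow> int) \<Rightarrow> ('s omod \<Rightarrow> int) \<Rightarrow> bool" where
  "chern_theory A c\<^sub>1 c\<^sub>2 \<longleftrightarrow>
     (\<forall>M k. omodule A M \<longrightarrow> isomorphic A M (line_bundle A k) \<longrightarrow> c\<^sub>1 M = k \<and> c\<^sub>2 M = 0) \<and>
     (\<forall>M' M M''. coherent_sheaf A M' \<longrightarrow> coherent_sheaf A M \<longrightarrow> coherent_sheaf A M'' \<longrightarrow>
        short_exact A M' M M'' \<longrightarrow>
        c\<^sub>1 M = c\<^sub>1 M' + c\<^sub>1 M'' \<and> c\<^sub>2 M = c\<^sub>2 M' + 5 * c\<^sub>1 M' * c\<^sub>1 M'' + c\<^sub>2 M'')"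

definition chern_c1 :: "(complex^(5 \<times> 5)) set \<Rightarrow> 's omod \<Rightarrow> int" where
  "chern_c1 A M = (THE k. \<exists>c\<^sub>1 c\<^sub>2. chern_theory A c\<^sub>1 c\<^sub>2 \<and> c\<^sub>1 M = k)"

definition chern_c2 :: "(complex^(5 \<times> 5)) set \<Rightarrow> 's omod \<Rightarrow> int" where
  "chern_c2 A M = (THE k. \<exists>c\<^sub>1 c\<^sub>2. chern_theory A c\<^sub>1 c\<^sub>2 \<and> c\<^sub>2 M = k)"

section \<open>Instantons\<close>

text \<open>\<open>\<mu>(F) = c\<^sub>1(F) \<cdot> h\<^sup>2 / rk F\<close>, where \<open>h\<^sup>3 = 5\<close>.\<close>

definition slope :: "(complex^(5 \<times> 5)) set \<Rightarrow> 's omod \<Rightarrow> real" where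
  "slope A F = 5 * of_int (chern_c1 A F) / of_nat (rank_of A F)"

definition mu_stable :: "(complex^(5 \<times> 5)) set \<Rightarrow> 's omod \<Rightarrow> bool" where
  "mu_stable A E \<longleftrightarrow> (\<forall>F :: 's omod. coherent_sheaf A F \<longrightarrow> (\<exists>\<iota>. mono_morphism A F E \<iota>) \<longrightarrow>
     0 < rank_of A F \<longrightarrow> rank_of A F < rank_of A E \<longrightarrow> slope A F < slope A E)"

text \<open>
  Vanishing of \<open>H\<^sup>1(Y, F)\<close>: the Cech group of every open cover vanishes.  For sheaf cohomology in
  degree 1 no refinement is needed, because the Cech \<open>H\<^sup>1\<close> of a cover injects into \<open>H\<^sup>1(Y, F)\<close>,
  which is the colimit of these groups.
\<close>

definition H1_vanishes :: "(complex^(5 \<times> 5)) set \<Rightarrow> 's omod \<Rightarrow> bool" where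
  "H1_vanishes A F \<longleftrightarrow>
     (\<forall>\<C> g. \<C> \<subseteq> opens A \<longrightarrow> \<Union>\<C> = Y A \<longrightarrow>
        (\<forall>U\<in>\<C>. \<forall>W\<in>\<C>. g U W \<in> carrier (sections F (U \<inter> W))) \<longrightarrow>
        (\<forall>U\<in>\<C>. \<forall>W\<in>\<C>. \<forall>X\<in>\<C>.
           restr F (U \<inter> W) (U \<inter> W \<inter> X) (g U W) \<oplus>\<^bsub>sections F (U \<inter> W \<inter> X)\<^esub>
           restr F (W \<inter> X) (U \<inter> W \<inter> X) (g W X) =
           restr F (U \<inter> X) (U \<inter> W \<inter> X) (g U X)) \<longrightarrow>
        (\<exists>t. (\<forall>U\<in>\<C>. t U \<in> carrier (sections F U)) \<and>
           (\<forall>U\<in>\<C>. \<forall>W\<in>\<C>.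
              g U W = restr F W (U \<inter> W) (t W) \<ominus>\<^bsub>sections F (U \<inter> W)\<^esub> restr F U (U \<inter> W) (t U))))"

definition instanton :: "(complex^(5 \<times> 5)) set \<Rightarrow> 's omod \<Rightarrow> bool" where
  "instanton A E \<longleftrightarrow> vector_bundle A E 2 \<and> mu_stable A E \<and> chern_c1 A E = 0 \<and>
     H1_vanishes A (twist A E (-1))"

definition charge :: "(complex^(5 \<times> 5)) set \<Rightarrow> 's omod \<Rightarrow> int" where
  "charge A E = chern_c2 A E"

section \<open>Monads\<close>

text \<open>
  An element of \<open>A \<otimes> S\<^sup>2H\<^sup>*\<close> is a symmetric \<open>n \<times> n\<close> matrix \<open>\<gamma>\<close> with entries in \<open>A\<close>.  The map
  \<open>\<gamma>'\<close> sends \<open>e\<^sub>h \<otimes> u\<close> to \<open>\<Sum>\<^sub>k e\<^sub>k\<^sup>* \<otimes> \<gamma>\<^sub>h\<^sub>k(u, _)\<close>.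
\<close>

definition tensors :: "(complex^(5 \<times> 5)) set \<Rightarrow> (complex^(5 \<times> 5)^'n^'n) set" where
  "tensors A = {\<gamma>. \<forall>h k. \<gamma> $ h $ k \<in> A \<and> \<gamma> $ h $ k = \<gamma> $ k $ h}"

definition gamma_fibre ::
  "complex^(5 \<times> 5)^('n::finite)^'n \<Rightarrow> complex^('n \<times> 5) \<Rightarrow> complex^('n \<times> 5)" where
  "gamma_fibre \<gamma> x =
     (\<chi> p. \<Sum>h\<in>UNIV. contract (\<gamma> $ h $ fst p) (component x h) $ snd p)"

definition gamma_sheaf ::
  "complex^(5 \<times> 5)^('n::finite)^'n \<Rightarrow> point set \<Rightarrow> (point \<Rightarrow> complex^('n \<times> 5)) \<Rightarrow> point \<Rightarrow> complex^('n \<times> 5)" where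
  "gamma_sheaf \<gamma> U s = (\<lambda>y\<in>U. gamma_fibre \<gamma> (s y))"

text \<open>
  The space \<open>H'\<close>, possibly zero, is a linear subspace of some coordinate space.
\<close>

definition monad_for ::
  "(complex^(5 \<times> 5)) set \<Rightarrow> 's omod \<Rightarrow> complex^(5 \<times> 5)^'n^'n \<Rightarrow> (complex^'m) set \<Rightarrow>
   (point set \<Rightarrow> (point \<Rightarrow> complex^('n \<times> 5)) \<Rightarrow> point \<Rightarrow> complex^'m) \<Rightarrow> bool" where
  "monad_for A E \<gamma> H' \<delta> \<longleftrightarrow>
     \<gamma> \<in> tensors A \<and>
     vec.subspace H' \<and> int (vec.dim H') = int CARD('n) - 2 \<and>
     (\<forall>y\<in>Y A. inj_on (gamma_fibre \<gamma>) (H_U_fibre y)) \<and>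
     epi_morphism A (fibre_sheaf A H_Uperp_fibre) (fibre_sheaf A (\<lambda>_. H')) \<delta> \<and>
     middle_cohomology A E (fibre_sheaf A H_U_fibre) (gamma_sheaf \<gamma>)
       (fibre_sheaf A H_Uperp_fibre) \<delta> (fibre_sheaf A (\<lambda>_. H'))"

text \<open>The linear map \<open>A\<^sup>* \<rightarrow> S\<^sup>2H\<^sup>*\<close> given by \<open>\<gamma>\<close>, with \<open>S\<^sup>2H\<^sup>*\<close> as symmetric matrices.\<close>

definition dual_space :: "(complex^(5 \<times> 5)) set \<Rightarrow> (complex^(5 \<times> 5) \<Rightarrow> complex) set" where
  "dual_space A = {\<phi> \<in> extensional A.
     (\<forall>a\<in>A. \<forall>b\<in>A. \<phi> (a + b) = \<phi> a + \<phi> b) \<and> (\<forall>c. \<forall>a\<in>A. \<phi> (c *s a) = c * \<phi> a)}"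

definition gamma_map ::
  "complex^(5 \<times> 5)^('n::finite)^'n \<Rightarrow> (complex^(5 \<times> 5) \<Rightarrow> complex) \<Rightarrow> complex^'n^'n" where
  "gamma_map \<gamma> \<phi> = (\<chi> h k. \<phi> (\<gamma> $ h $ k))"

end

theory Submission
  imports Defs "HOL-Computational_Algebra.Fundamental_Theorem_Algebra"
begin

text \<open>
  If \<open>\<gamma>\<close> is not injective, then it takes values in a pencil \<open>\<langle>a, b\<rangle> \<subseteq> A\<close>, so it is given by two
  square matrices \<open>M\<close>, \<open>N\<close>.  Some member \<open>s M + t N\<close> of the pencil is singular, and for \<open>h\<close> in its
  kernel \<open>\<gamma>(h, _)\<close> is a multiple of a single form \<open>c\<close>.  As \<open>dim V\<close> is odd, \<open>c\<close> has a kernel vector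
  \<open>v \<noteq> 0\<close>, and the three conditions that \<open>A\<close> imposes on a second vector \<open>w \<in> V\<close> leave room for a
  plane of \<open>Y\<close> through \<open>v\<close>.  At that point of \<open>Y\<close> the vector \<open>h \<otimes> v\<close> is killed by \<open>\<gamma>'\<close>,
  which contradicts fibrewise injectivity.
\<close>

section \<open>Determinants and singular members of matrix pencils\<close>

lemma det_zero_iff_kernel:
  fixes M :: "'a::field^'n^'n"
  shows "det M = 0 \<longleftrightarrow> (\<exists>x. x \<noteq> 0 \<and> M *v x = 0)"
  using invertible_det_nz[of M] invertible_left_inverse[of M] matrix_left_invertible_ker[of M]
  by auto

lemma det_uminus:
  fixes M :: "'a::comm_ring_1^'n^'n"
  shows "det (- M) = (- 1) ^ CARD('n) * det M"
proof -
  have "- M = (\<chi> i. (- 1) *s M $ i)"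
    by (simp add: vec_eq_iff)
  then show ?thesis
    using det_rows_mul[of "\<lambda>_. - 1" "\<lambda>i. M $ i"] by simp
qed

text \<open>Transposing keeps the determinant, negating an odd number of rows changes its sign, and
  2 is invertible in the complex numbers.\<close>

lemma skew_det_zero:
  fixes M :: "complex^'n^'n"
  assumes "transpose M = - M" and "odd CARD('n)"
  shows "det M = 0"
proof -
  have "det M = det (- M)"
    using det_transpose[of M] assms(1) by simp
  also have "\<dots> = - det M"
    using assms(2) by (simp add: det_uminus)
  finally show ?thesis by simp
qed

text \<open>Each term of the Leibniz expansion is a product of linear polynomials in
  \<open>t\<close>; having a polynomial makes the fundamental theorem of algebra available.\<close>

lemma det_pencil_poly:
  fixes M N :: "complex^'n^'n"
  obtains p where "\<And>t. poly p t = det (\<chi> i j. M $ i $ j + t * N $ i $ j)"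
proof
  fix t
  show "poly (\<Sum>q | q permutes (UNIV :: 'n set).
        [:of_int (sign q):] * (\<Prod>i\<in>UNIV. [:M $ i $ q i, N $ i $ q i:])) t =
      det (\<chi> i j. M $ i $ j + t * N $ i $ j)"
    unfolding det_def poly_sum by (intro sum.cong) (simp_all add: poly_prod)
qed

text \<open>The determinant of \<open>s M + t N\<close> is a binary form of positive degree in
  \<open>s\<close> and \<open>t\<close>, so it vanishes somewhere on the projective line. In the
  chart \<open>s = 1\<close> this is the fundamental theorem of algebra; if no root lies there, the
  point at infinity \<open>(0, 1)\<close> is one.\<close>

lemma pencil_singular_member:
  fixes M N :: "complex^'n^'n"
  obtains s t where "(s, t) \<noteq> (0, 0)" and "det (\<chi> i j. s * M $ i $ j + t * N $ i $ j) = 0"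
proof (cases "\<exists>t. det (\<chi> i j. M $ i $ j + t * N $ i $ j) = 0")
  case True
  then obtain t where "det (\<chi> i j. M $ i $ j + t * N $ i $ j) = 0" ..
  then show ?thesis
    by (intro that[of 1 t]) auto
next
  case False
  obtain p where p: "\<And>t. poly p t = det (\<chi> i j. M $ i $ j + t * N $ i $ j)"
    using det_pencil_poly[of M N] by blast
  obtain q where q: "\<And>s. poly q s = det (\<chi> i j. N $ i $ j + s * M $ i $ j)"
    using det_pencil_poly[of N M] by blast
  have "constant (poly p)"
    using fundamental_theorem_of_algebra[of p] False p by auto
  then have const: "poly p t = poly p 0" for t
    by (auto simp: constant_def)
  \<comment> \<open>Factoring \<open>s\<close> out of every row of \<open>N + s M\<close> leaves
    \<open>M + inverse s N\<close>, whose determinant is the constant value of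
    \<open>p\<close>.\<close>
  have eq: "poly q s = s ^ CARD('n) * poly p 0" if "s \<noteq> 0" for s
  proof -
    have "(\<chi> i j. N $ i $ j + s * M $ i $ j) =
        (\<chi> i. s *s (\<chi> j. M $ i $ j + inverse s * N $ i $ j))"
      using that by (simp add: vec_eq_iff algebra_simps)
    then have "poly q s = s ^ CARD('n) * poly p (inverse s)"
      using det_rows_mul[of "\<lambda>_. s" "\<lambda>i. \<chi> j. M $ i $ j + inverse s * N $ i $ j"]
      by (simp add: p q)
    then show ?thesis using const by simp
  qed
  \<comment> \<open>The identity \<open>eq\<close> omits \<open>s = 0\<close>, the value needed;
    continuity of \<open>q\<close> supplies it, and \<open>0 ^ CARD('n)\<close> is 0 because index
    types are non-empty.\<close>
  have "poly q \<midarrow>0\<rightarrow> 0 ^ CARD('n) * poly p 0"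
    by (rule Lim_transform_eventually[where f = "\<lambda>s. s ^ CARD('n) * poly p 0"])
      (auto intro!: tendsto_intros simp: eq eventually_at intro: exI[of _ 1])
  moreover have "poly q \<midarrow>0\<rightarrow> poly q 0"
    using poly_isCont[of 0 q] by (simp add: isCont_def)
  ultimately have "poly q 0 = 0 ^ CARD('n) * poly p 0"
    by (rule LIM_unique[rotated])
  then have "det (\<chi> i j. 0 * M $ i $ j + 1 * N $ i $ j) = 0"
    by (simp add: q)
  then show ?thesis
    by (intro that[of 0 1]) auto
qed

section \<open>Subspaces spanned by two vectors\<close>

lemma vec_span_pair: "x \<in> vec.span {a, b} \<longleftrightarrow> (\<exists>p q. x = p *s a + q *s b)"
proof -
  have "x \<in> vec.span {a, b} \<longleftrightarrow> (\<exists>p q. x - p *s a = q *s b)"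
    by (auto simp: vec.span_insert[of a] vec.span_singleton)
  then show ?thesis
    by (simp add: diff_eq_eq add.commute)
qed

text \<open>The generators may coincide or vanish, which covers the dimensions 0 and 1 as
  well.\<close>

lemma span_pair_if_dim_le_2:
  assumes "vec.subspace S" and "vec.dim S \<le> 2"
  obtains a b where "S = vec.span {a, b}"
proof -
  obtain B where B: "B \<subseteq> S" "vec.span B = S" "card B = vec.dim S" "vec.independent B"
    using vec.basis_exists[of S] vec.span_subspace[OF _ _ assms(1)] by metis
  have fin: "finite B"
    using B(4) vec.finiteI_independent by blast
  have "\<exists>a b. vec.span {a, b} = vec.span B"
  proof -
    consider "card B = 0" | "card B = 1" | "card B = 2"
      using B(3) assms(2) by linarith
    then show ?thesis
    proof cases
      case 1
      then show ?thesis
        using fin by (intro exI[of _ 0]) (simp add: vec.span_insert_0)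
    next
      case 2
      then obtain x where "B = {x}"
        by (auto simp: card_1_singleton_iff)
      then show ?thesis
        by (intro exI[of _ x]) simp
    next
      case 3
      then show ?thesis
        by (auto simp: card_2_iff)
    qed
  qed
  then show ?thesis
    using that B(2) by auto
qed

section \<open>Alternating forms on \<open>V\<close> and the planes that belong to
  \<open>Y\<close>\<close>

lemma form_contract: "form a v w = (\<Sum>j\<in>UNIV. contract a v $ j * w $ j)"
proof -
  have "form a v w = (\<Sum>j\<in>UNIV. \<Sum>i\<in>UNIV. a $ (i, j) * v $ i * w $ j)"
    unfolding form_def by (rule sum.swap)
  then show ?thesis
    by (simp add: contract_def sum_distrib_right)
qed

lemma form_add_left: "form a (u + v) w = form a u w + form a v w"
  and form_add_right: "form a u (v + w) = form a u v + form a u w"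
  and form_scale_left: "form a (c *s u) w = c * form a u w"
  and form_scale_right: "form a u (c *s w) = c * form a u w"
  and form_add: "form (a + b) u w = form a u w + form b u w"
  and form_scale: "form (c *s a) u w = c * form a u w"
  by (simp_all add: form_def algebra_simps sum.distrib sum_distrib_left)

lemma form_zero: "form 0 u w = 0"
  by (simp add: form_def)

lemma alternating_form_swap:
  assumes "alternating_form a"
  shows "form a v w = - form a w v"
proof -
  have "form a (v + w) (v + w) = 0" and "form a v v = 0" and "form a w w = 0"
    using assms by (auto simp: alternating_form_def)
  then show ?thesis
    by (simp add: form_add_left form_add_right add_eq_0_iff)
qed

lemma form_axis: "form a (axis i 1) (axis j 1) = a $ (i, j)"
proof -
  have "form a (axis i 1) (axis j 1) =
      (\<Sum>i'\<in>UNIV. \<Sum>j'\<in>UNIV. if i' = i then if j' = j then a $ (i', j') else 0 else 0)"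
    unfolding form_def by (intro sum.cong) (auto simp: axis_def)
  also have "\<dots> = (\<Sum>i'\<in>UNIV. if i' = i then a $ (i', j) else 0)"
    by (intro sum.cong) auto
  finally show ?thesis by simp
qed

text \<open>The Gram matrix of an alternating form is skew-symmetric of odd size 5, hence
  singular.\<close>

lemma alternating_form_kernel:
  assumes "alternating_form a"
  obtains v where "v \<noteq> 0" and "contract a v = 0"
proof -
  \<comment> \<open>The indices are swapped so that \<open>M *v v\<close> is
    \<open>contract a v\<close>.\<close>
  define M :: "complex^5^5" where "M = (\<chi> j i. a $ (i, j))"
  have "\<And>i j. a $ (i, j) = - a $ (j, i)"
    using alternating_form_swap[OF assms] form_axis by metis
  then have "transpose M = - M"
    unfolding M_def transpose_def vec_eq_iff by (metis (no_types) uminus_vec_def vec_lambda_beta)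
  then have "det M = 0"
    by (intro skew_det_zero) auto
  then obtain v where "v \<noteq> 0" "M *v v = 0"
    by (auto simp: det_zero_iff_kernel)
  moreover have "contract a v = M *v v"
    by (simp add: contract_def M_def matrix_vector_mult_def)
  ultimately show ?thesis
    using that by auto
qed

text \<open>A plane through \<open>v\<close> is isotropic for \<open>A\<close> once its second
  generator \<open>w\<close> satisfies three linear equations, one for each basis form. With a
  fourth equation \<open>w $ k = 0\<close>, where \<open>v $ k\<close> is non-zero, a non-zero
  solution still exists in dimension 5, and it is independent of \<open>v\<close>.\<close>

lemma Y_through_vector:
  assumes A: "vec.subspace A" "vec.dim A = 3" "\<forall>a\<in>A. alternating_form a" and "v \<noteq> 0"
  obtains L where "L \<in> Y A" and "v \<in> L"
proof -
  obtain B where B: "B \<subseteq> A" "A \<subseteq> vec.span B" "card B = 3"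
    using vec.basis_exists[of A] A(2) by metis
  then obtain a b c where abc: "B = {a, b, c}"
    by (auto simp: card_3_iff)
  obtain k where k: "v $ k \<noteq> 0"
    using \<open>v \<noteq> 0\<close> by (auto simp: vec_eq_iff)
  \<comment> \<open>The zero row makes \<open>M\<close> singular; the row \<open>axis k 1\<close> keeps \<open>w\<close> off the line of \<open>v\<close>.\<close>
  define M :: "complex^5^5" where
    "M = (\<chi> i. if i = 0 then 0 else if i = 1 then axis k 1 else
       if i = 2 then contract a v else if i = 3 then contract b v else contract c v)"
  have rows: "M $ 0 = 0" "M $ 1 = axis k 1" "M $ 2 = contract a v" "M $ 3 = contract b v"
    "M $ 4 = contract c v"
    by (simp_all add: M_def)
  have "det M = 0"
    by (rule det_zero_row(1)[of 0]) (simp add: rows row_def vec_eq_iff)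
  then obtain w where w: "w \<noteq> 0" "M *v w = 0"
    by (auto simp: det_zero_iff_kernel)
  have row: "(\<Sum>j\<in>UNIV. M $ i $ j * w $ j) = 0" for i
    using w(2) by (simp add: matrix_vector_mult_def vec_eq_iff)
  have wk: "w $ k = 0"
    using row[of 1] by (simp add: rows axis_def if_distrib[of "\<lambda>x. x * _"] cong: if_cong)
  have B0: "form d v w = 0" if "d \<in> B" for d
    using that row[of 2] row[of 3] row[of 4] by (auto simp: abc rows form_contract)
  have A0: "form d v w = 0" if "d \<in> A" for d
  proof -
    have "d \<in> vec.span B" using B(2) that by auto
    then show ?thesis
      by (induction rule: vec.span_induct_alt)
        (simp_all add: form_zero form_add form_scale B0)
  qed
  define L where "L = vec.span {v, w}"
  have "v \<noteq> w"
    using k wk by auto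
  moreover have "v \<notin> vec.span {w}"
    using k wk by (auto simp: vec.span_singleton)
  ultimately have "vec.independent {v, w}"
    using w(1) by (simp add: vec.independent_insert)
  then have "vec.dim L = 2"
    using \<open>v \<noteq> w\<close> by (simp add: L_def vec.dim_eq_card_independent)
  moreover have "form d x y = 0" if d: "d \<in> A" and xy: "x \<in> L" "y \<in> L" for d x y
  proof -
    have alt: "alternating_form d" using A(3) d by auto
    then have zero: "form d v v = 0" "form d w w = 0" "form d v w = 0" "form d w v = 0"
      using A0[OF d] alternating_form_swap[OF alt, of w v] by (auto simp: alternating_form_def)
    obtain p q where "x = p *s v + q *s w"
      using xy(1) by (auto simp: L_def vec_span_pair)
    moreover obtain r s where "y = r *s v + s *s w"
      using xy(2) by (auto simp: L_def vec_span_pair)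
    ultimately show ?thesis
      by (simp add: form_add_left form_add_right form_scale_left form_scale_right zero)
  qed
  ultimately have "L \<in> Y A"
    by (simp add: Y_def L_def vec.subspace_span)
  then show ?thesis
    by (rule that) (simp add: L_def vec.span_base)
qed

section \<open>Functionals on \<open>A\<close> and contraction of tensors with values in a
  pencil\<close>

lemma dual_space_zero:
  assumes "\<phi> \<in> dual_space A" and "0 \<in> A"
  shows "\<phi> 0 = 0"
proof -
  have "\<phi> (0 *s 0) = 0 * \<phi> 0"
    using assms unfolding dual_space_def by blast
  then show ?thesis by simp
qed

text \<open>This locus is the kernel of the non-zero functional \<open>\<phi> - \<psi>\<close> on a
  space of dimension 3.\<close>

lemma agreement_locus_span_pair:
  assumes A: "vec.subspace A" "vec.dim A = 3"
    and \<phi>: "\<phi> \<in> dual_space A" and \<psi>: "\<psi> \<in> dual_space A" and "\<phi> \<noteq> \<psi>"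
  obtains a b where "{c \<in> A. \<phi> c = \<psi> c} = vec.span {a, b}"
proof -
  define S where "S = {c \<in> A. \<phi> c = \<psi> c}"
  have sub: "vec.subspace S"
    using A(1) \<phi> \<psi> dual_space_zero[OF \<phi>] dual_space_zero[OF \<psi>]
    by (auto simp: S_def vec.subspace_def dual_space_def)
  obtain c where c: "\<phi> c \<noteq> \<psi> c"
    using \<open>\<phi> \<noteq> \<psi>\<close> by (auto simp: fun_eq_iff)
  \<comment> \<open>Members of \<open>dual_space A\<close> are \<open>undefined\<close> off
    \<open>A\<close>, so they can differ only at a point of \<open>A\<close>.\<close>
  have "c \<in> A"
    using c \<phi> \<psi> unfolding dual_space_def
    by (metis (no_types, lifting) mem_Collect_eq extensional_arb)
  then have "S \<noteq> A"
    using c by (auto simp: S_def)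
  moreover have "S \<subseteq> A"
    by (auto simp: S_def)
  ultimately have "vec.dim S < 3"
    using vec.subspace_dim_equal[OF sub A(1)] A(2) by force
  then obtain a b where "S = vec.span {a, b}"
    using span_pair_if_dim_le_2[OF sub] by auto
  then show ?thesis
    using that by (simp add: S_def)
qed

text \<open>For \<open>x\<close> in the kernel of a singular member \<open>s M + t N\<close>, the
  two coefficients of the contracted entry at \<open>k\<close> satisfy a linear relation that does
  not depend on \<open>k\<close>, so every such entry is a multiple of
  \<open>t a - s b\<close>.\<close>

lemma rank_one_contraction:
  fixes \<gamma> :: "complex^'i^('n::finite)^'n"
  assumes "\<And>h k. \<gamma> $ h $ k \<in> vec.span {a, b}"
  obtains x c m where "x \<noteq> 0" and "c \<in> vec.span {a, b}"
    and "\<And>k. (\<Sum>h\<in>UNIV. x $ h *s \<gamma> $ h $ k) = m k *s c"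
proof -
  have "\<exists>p q. \<gamma> $ h $ k = p *s a + q *s b" for h k
    using assms[of h k] by (simp add: vec_span_pair)
  then obtain p q where pq: "\<And>h k. \<gamma> $ h $ k = p h k *s a + q h k *s b"
    by metis
  define M :: "complex^'n^'n" where "M = (\<chi> k h. p h k)"
  define N :: "complex^'n^'n" where "N = (\<chi> k h. q h k)"
  obtain s t where st: "(s, t) \<noteq> (0, 0)" and "det (\<chi> i j. s * M $ i $ j + t * N $ i $ j) = 0"
    using pencil_singular_member[of M N] by blast
  then obtain x where x: "x \<noteq> 0" "(\<chi> i j. s * M $ i $ j + t * N $ i $ j) *v x = 0"
    by (auto simp: det_zero_iff_kernel)
  define \<mu> \<nu> where "\<mu> = M *v x" and "\<nu> = N *v x"
  have rel: "s * \<mu> $ k + t * \<nu> $ k = 0" for k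
  proof -
    have "s * \<mu> $ k + t * \<nu> $ k = ((\<chi> i j. s * M $ i $ j + t * N $ i $ j) *v x) $ k"
      by (simp add: \<mu>_def \<nu>_def matrix_vector_mult_def algebra_simps sum.distrib sum_distrib_left)
    then show ?thesis by (simp add: x(2))
  qed
  have sum: "(\<Sum>h\<in>UNIV. x $ h *s \<gamma> $ h $ k) = \<mu> $ k *s a + \<nu> $ k *s b" for k
    by (simp add: vec_eq_iff pq \<mu>_def \<nu>_def M_def N_def matrix_vector_mult_def sum.distrib
        sum_distrib_left sum_distrib_right algebra_simps)
  have ab: "a \<in> vec.span {a, b}" "b \<in> vec.span {a, b}"
    by (auto intro: vec.span_base)
  \<comment> \<open>By \<open>rel\<close> each pair of coefficients is proportional to
    \<open>(t, - s)\<close>; the factor comes from dividing by whichever of \<open>s\<close> and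
    \<open>t\<close> is non-zero.\<close>
  have "\<exists>m. \<forall>k. \<mu> $ k = m k * t \<and> \<nu> $ k = - (m k * s)"
  proof (cases "s = 0")
    case True
    then have "t \<noteq> 0" "\<nu> $ k = 0" for k
      using st rel[of k] by auto
    then show ?thesis
      by (intro exI[of _ "\<lambda>k. \<mu> $ k / t"]) (simp add: True)
  next
    case False
    then show ?thesis
      using rel by (intro exI[of _ "\<lambda>k. - \<nu> $ k / s"]) (auto simp: field_simps add_eq_0_iff)
  qed
  then obtain m where m: "\<And>k. \<mu> $ k = m k * t" "\<And>k. \<nu> $ k = - (m k * s)"
    by metis
  show ?thesis
  proof (rule that[OF x(1), of "t *s a - s *s b" m])
    show "t *s a - s *s b \<in> vec.span {a, b}"
      using ab by (intro vec.span_diff vec.span_scale)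
    show "(\<Sum>h\<in>UNIV. x $ h *s \<gamma> $ h $ k) = m k *s (t *s a - s *s b)" for k
      by (simp add: sum m vec_eq_iff algebra_simps)
  qed
qed

section \<open>Injectivity of the linear map given by the monad\<close>

theorem theorem4p17:
  fixes A :: "(complex^(5 \<times> 5)) set"
    and E :: "'s omod"
    and \<gamma> :: "complex^(5 \<times> 5)^'n^'n"
    and H' :: "(complex^'m) set"
    and \<delta> :: "point set \<Rightarrow> (point \<Rightarrow> complex^('n \<times> 5)) \<Rightarrow> point \<Rightarrow> complex^'m"
  assumes "sl2_net A"
    and "instanton A E" and "charge A E = int CARD('n)"
    and "monad_for A E \<gamma> H' \<delta>"
  shows "inj_on (gamma_map \<gamma>) (dual_space A)"
proof (rule inj_onI, rule ccontr)
  fix \<phi> \<psi>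
  assume \<phi>: "\<phi> \<in> dual_space A" and \<psi>: "\<psi> \<in> dual_space A"
    and eq: "gamma_map \<gamma> \<phi> = gamma_map \<gamma> \<psi>" and ne: "\<phi> \<noteq> \<psi>"
  have A: "vec.subspace A" "vec.dim A = 3" "\<forall>a\<in>A. alternating_form a"
    using assms(1) by (auto simp: sl2_net_def)
  have inj: "inj_on (gamma_fibre \<gamma>) (H_U_fibre L)" if "L \<in> Y A" for L
    using assms(4) that by (auto simp: monad_for_def)
  have \<gamma>A: "\<gamma> $ h $ k \<in> A" for h k
    using assms(4) by (auto simp: monad_for_def tensors_def)
  obtain a b where ab: "{c \<in> A. \<phi> c = \<psi> c} = vec.span {a, b}"
    using agreement_locus_span_pair[OF A(1,2) \<phi> \<psi> ne] by blast
  have "\<phi> (\<gamma> $ h $ k) = \<psi> (\<gamma> $ h $ k)" for h k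
    using eq by (simp add: gamma_map_def vec_eq_iff)
  then have "\<gamma> $ h $ k \<in> vec.span {a, b}" for h k
    using ab \<gamma>A by blast
  then obtain x c m where x: "x \<noteq> 0" and c: "c \<in> vec.span {a, b}"
    and m: "\<And>k. (\<Sum>h\<in>UNIV. x $ h *s \<gamma> $ h $ k) = m k *s c"
    using rank_one_contraction[of \<gamma> a b] by blast
  have "alternating_form c"
    using c ab A(3) by blast
  then obtain v where v: "v \<noteq> 0" "contract c v = 0"
    by (rule alternating_form_kernel)
  obtain L where L: "L \<in> Y A" "v \<in> L"
    by (rule Y_through_vector[OF A v(1)])
  have sub: "vec.subspace L"
    using L(1) by (simp add: Y_def)
  \<comment> \<open>This is the decomposable tensor of \<open>x\<close> and \<open>v\<close>; its
    components are multiples of \<open>v\<close>, so it lies in the fibre over any plane through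
    \<open>v\<close>.\<close>
  define z :: "complex^('n \<times> 5)" where "z = (\<chi> p. x $ fst p * v $ snd p)"
  have comp: "component z h = x $ h *s v" for h
    by (simp add: component_def z_def vec_eq_iff)
  have "z \<in> H_U_fibre L"
    using L(2) sub by (simp add: H_U_fibre_def comp vec.subspace_scale)
  moreover have "(0 :: complex^('n \<times> 5)) \<in> H_U_fibre L"
  proof -
    have "component (0 :: complex^('n \<times> 5)) h = 0" for h
      by (simp add: component_def vec_eq_iff)
    then show ?thesis
      using vec.subspace_0[OF sub] by (simp add: H_U_fibre_def)
  qed
  moreover have "gamma_fibre \<gamma> z = gamma_fibre \<gamma> 0"
  proof -
    \<comment> \<open>Exchanging the sums contracts \<open>\<gamma>\<close> with \<open>x\<close>
      first, which leaves \<open>m k\<close> times \<open>contract c v\<close>, and \<open>v\<close>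
      was chosen in the kernel of \<open>c\<close>.\<close>
    have "(\<Sum>h\<in>UNIV. contract (\<gamma> $ h $ k) (x $ h *s v) $ j) = 0" for k j
    proof -
      have "(\<Sum>h\<in>UNIV. contract (\<gamma> $ h $ k) (x $ h *s v) $ j) =
          (\<Sum>h\<in>UNIV. \<Sum>i\<in>UNIV. x $ h * \<gamma> $ h $ k $ (i, j) * v $ i)"
        by (simp add: contract_def algebra_simps)
      also have "\<dots> = (\<Sum>i\<in>UNIV. \<Sum>h\<in>UNIV. x $ h * \<gamma> $ h $ k $ (i, j) * v $ i)"
        by (rule sum.swap)
      also have "\<dots> = (\<Sum>i\<in>UNIV. (\<Sum>h\<in>UNIV. x $ h *s \<gamma> $ h $ k) $ (i, j) * v $ i)"
        by (simp add: sum_distrib_right)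
      also have "\<dots> = m k * contract c v $ j"
        by (simp add: m contract_def sum_distrib_left algebra_simps)
      finally show ?thesis by (simp add: v(2))
    qed
    then show ?thesis
      by (simp add: gamma_fibre_def comp vec_eq_iff) (simp add: component_def contract_def)
  qed
  ultimately have "z = 0"
    using inj_onD[OF inj[OF L(1)]] by blast
  moreover obtain h where "x $ h \<noteq> 0"
    using x by (auto simp: vec_eq_iff)
  moreover obtain i where "v $ i \<noteq> 0"
    using v(1) by (auto simp: vec_eq_iff)
  ultimately show False
    by (auto simp: z_def vec_eq_iff)
qed

end
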